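(* For the problem of minimizing makespan for online job scheduling on $m \ge 2$ identical machines, $\textsc{Greedy}$ has online bounded ratio exactly $2-\frac{1}{m-1}$.
   Context: Jobs with positive sizes arrive online and each must be assigned irrevocably (without preemption) to one of $m$ identical machines; the load of a machine is the total size of jobs assigned to it, and the makespan is the maximum load; the goal is to minimize the makespan. $\textsc{Greedy}$ assigns each job to a currently least loaded machine (ties arbitrary). For a deterministic online algorithm $A$ of a minimization problem, $\textsc{Opt}_A$ denotes an offline algorithm that is optimal among offline algorithms whose solution on any input $I$ satisfies, for every prefix $I'$ of $I$, that the cost of the solution restricted to $I'$ is at most $A(I')$. The online bounded ratio of $A$ is the infimum of all constants $c$ such that $A(I) \le c\,\textsc{Opt}_A(I)$ for all inputs $I$. *)

theory Defs
  imports Complex_Main "HOL-Library.Extended_Real" "HOL-Library.Sublist"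
begin

definition valid_input :: "real list \<Rightarrow> bool" where
  "valid_input I \<longleftrightarrow> (\<forall>p \<in> set I. p > 0)"

text \<open>
  A solution \<open>\<sigma>\<close> maps the index of a job to the machine (one of \<open>0, \<dots>, m - 1\<close>)
  it is assigned to. Only the values at the indices of the jobs of the input matter, so the
  restriction of \<open>\<sigma>\<close> to a prefix \<open>J\<close> of the input is again \<open>\<sigma>\<close>, read as a solution for \<open>J\<close>.
\<close>

definition load :: "real list \<Rightarrow> (nat \<Rightarrow> nat) \<Rightarrow> nat \<Rightarrow> real" where
  "load I \<sigma> k = (\<Sum>i \<in> {i. i < length I \<and> \<sigma> i = k}. I ! i)"

definition makespan :: "nat \<Rightarrow> real list \<Rightarrow> (nat \<Rightarrow> nat) \<Rightarrow> real" where
  "makespan m I \<sigma> = Max (load I \<sigma> ` {..<m})"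

definition is_solution :: "nat \<Rightarrow> real list \<Rightarrow> (nat \<Rightarrow> nat) \<Rightarrow> bool" where
  "is_solution m I \<sigma> \<longleftrightarrow> (\<forall>i < length I. \<sigma> i < m)"

text \<open>
  A deterministic online algorithm chooses a machine from the list of the earlier jobs and the
  size of the current job; its own earlier decisions are determined by the earlier jobs.
\<close>

type_synonym online_alg = "real list \<Rightarrow> real \<Rightarrow> nat"

type_synonym offline_alg = "real list \<Rightarrow> nat \<Rightarrow> nat"

definition run :: "online_alg \<Rightarrow> real list \<Rightarrow> nat \<Rightarrow> nat" where
  "run A I = (\<lambda>i. A (take i I) (I ! i))"

definition online_cost :: "nat \<Rightarrow> online_alg \<Rightarrow> real list \<Rightarrow> real" where
  "online_cost m A I = makespan m I (run A I)"

text \<open>The tie-breaking rule is left open: every online algorithm with this property is a Greedy.\<close>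

definition is_greedy :: "nat \<Rightarrow> online_alg \<Rightarrow> bool" where
  "is_greedy m A \<longleftrightarrow>
     (\<forall>I p. valid_input I \<and> p > 0 \<longrightarrow>
        A I p < m \<and> (\<forall>k < m. load I (run A I) (A I p) \<le> load I (run A I) k))"

definition is_bounded_by :: "nat \<Rightarrow> online_alg \<Rightarrow> offline_alg \<Rightarrow> bool" where
  "is_bounded_by m A B \<longleftrightarrow>
     (\<forall>I. valid_input I \<longrightarrow>
        is_solution m I (B I) \<and>
        (\<forall>J. prefix J I \<longrightarrow> makespan m J (B I) \<le> online_cost m A J))"

definition is_opt_bounded_by :: "nat \<Rightarrow> online_alg \<Rightarrow> offline_alg \<Rightarrow> bool" where
  "is_opt_bounded_by m A B \<longleftrightarrow>
     is_bounded_by m A B \<and>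
     (\<forall>C. is_bounded_by m A C \<longrightarrow>
        (\<forall>I. valid_input I \<longrightarrow> makespan m I (B I) \<le> makespan m I (C I)))"

text \<open>
  Any two algorithms satisfying \<^const>\<open>is_opt_bounded_by\<close> have the same cost on every valid input,
  so the choice below does not affect the cost.
\<close>

definition Opt :: "nat \<Rightarrow> online_alg \<Rightarrow> offline_alg" where
  "Opt m A = (SOME B. is_opt_bounded_by m A B)"

definition opt_cost :: "nat \<Rightarrow> online_alg \<Rightarrow> real list \<Rightarrow> real" where
  "opt_cost m A I = makespan m I (Opt m A I)"

text \<open>The infimum is taken in the extended reals, so it is \<open>\<infinity>\<close> if no constant is admissible.\<close>

definition online_bounded_ratio :: "nat \<Rightarrow> online_alg \<Rightarrow> ereal" where
  "online_bounded_ratio m A =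
     Inf {ereal c | c. \<forall>I. valid_input I \<longrightarrow> online_cost m A I \<le> c * opt_cost m A I}"

end

theory Submission imports Defs begin

text \<open>
  Upper bound: let \<open>p\<close> be the last job that raises Greedy's makespan, let \<open>L\<close> and \<open>M\<close> be
  Greedy's least and greatest load just before \<open>p\<close>, let \<open>C\<close> be the final makespan of a solution
  bounded by Greedy, and let \<open>q\<close> be the load, before \<open>p\<close>, of the machine on which that solution
  places \<open>p\<close>. The total size of the jobs before \<open>p\<close> is at least \<open>(m - 1) L + M\<close>, and it is at most
  \<open>q + (m - 1) min M C \<le> q + M + (m - 2) C\<close>. Hence \<open>(m - 1) L \<le> q + (m - 2) C\<close>, and \<open>p + q \<le> C\<close>
  gives \<open>(m - 1) (L + p) \<le> (2 m - 3) C\<close>.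

  Lower bound: a job of size \<open>m - 1\<close>, then \<open>(m - 1) (m - 2)\<close> unit jobs, then another job of size
  \<open>m - 1\<close>. After the first job every solution of makespan \<open>m - 1\<close> is bounded by Greedy, and
  one exists, whereas Greedy spreads the unit jobs over \<open>m - 1\<close> machines and ends with \<open>2 m - 3\<close>.
\<close>

section \<open>Loads and makespans of arbitrary solutions\<close>

lemma load_Nil [simp]: "load [] \<sigma> k = 0"
  by (simp add: load_def)

lemma load_cong:
  assumes "\<And>i. i < length I \<Longrightarrow> \<sigma> i = \<tau> i"
  shows "load I \<sigma> k = load I \<tau> k"
  unfolding load_def by (rule sum.cong) (auto simp: assms)

lemma load_snoc: "load (I @ [p]) \<sigma> k = load I \<sigma> k + (if \<sigma> (length I) = k then p else 0)"
proof -
  have "{i. i < length (I @ [p]) \<and> \<sigma> i = k} =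
      {i. i < length I \<and> \<sigma> i = k} \<union> (if \<sigma> (length I) = k then {length I} else {})"
    by (auto simp: less_Suc_eq)
  moreover have "(\<Sum>i \<in> {i. i < length I \<and> \<sigma> i = k}. (I @ [p]) ! i) =
      (\<Sum>i \<in> {i. i < length I \<and> \<sigma> i = k}. I ! i)"
    by (rule sum.cong) (auto simp: nth_append)
  ultimately show ?thesis
    by (auto simp: load_def sum.union_disjoint)
qed

lemma run_snoc_less: "i < length I \<Longrightarrow> run A (I @ [p]) i = run A I i"
  by (simp add: run_def nth_append)

lemma load_run_snoc: "load (I @ [p]) (run A (I @ [p])) k =
    load I (run A I) k + (if A I p = k then p else 0)"
proof -
  have "run A (I @ [p]) (length I) = A I p"
    by (simp add: run_def)
  moreover have "load I (run A (I @ [p])) k = load I (run A I) k"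
    by (rule load_cong) (rule run_snoc_less)
  ultimately show ?thesis
    by (simp only: load_snoc)
qed

lemma valid_input_append [simp]: "valid_input (I @ J) \<longleftrightarrow> valid_input I \<and> valid_input J"
  by (auto simp: valid_input_def)

lemma valid_input_Cons [simp]: "valid_input (p # I) \<longleftrightarrow> p > 0 \<and> valid_input I"
  by (auto simp: valid_input_def)

lemma load_append_ge: "valid_input (I @ J) \<Longrightarrow> load I \<sigma> k \<le> load (I @ J) \<sigma> k"
proof (induction J rule: rev_induct)
  case (snoc p J)
  then show ?case
    using load_snoc[of "I @ J" p \<sigma> k] by (fastforce split: if_splits)
qed simp

lemma load_mono_prefix: "valid_input I \<Longrightarrow> prefix J I \<Longrightarrow> load J \<sigma> k \<le> load I \<sigma> k"
  by (auto simp: prefix_def intro: load_append_ge)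

lemma load_nonneg: "valid_input I \<Longrightarrow> 0 \<le> load I \<sigma> k"
  using load_mono_prefix[of I "[]"] by simp

text \<open>The total on the right does not depend on \<sigma>. This is the link through which
  Greedy's loads are compared with those of another solution for the same jobs.\<close>

lemma sum_load:
  "is_solution m I \<sigma> \<Longrightarrow> (\<Sum>k<m. load I \<sigma> k) = sum_list I"
proof (induction I rule: rev_induct)
  case (snoc p I)
  then show ?case
    by (auto simp: load_snoc sum.distrib is_solution_def)
qed simp

lemma makespan_ge: "k < m \<Longrightarrow> load I \<sigma> k \<le> makespan m I \<sigma>"
  unfolding makespan_def by (rule Max_ge) auto

lemma makespan_attained:
  assumes "m > 0"
  obtains k where "k < m" "makespan m I \<sigma> = load I \<sigma> k"
proof -
  have "Max (load I \<sigma> ` {..<m}) \<in> load I \<sigma> ` {..<m}"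
    using assms by (intro Max_in) auto
  then show ?thesis
    using that by (auto simp: makespan_def)
qed

lemma makespan_mono_prefix:
  assumes "m > 0" "valid_input I" "prefix J I"
  shows "makespan m J \<sigma> \<le> makespan m I \<sigma>"
proof -
  obtain k where "k < m" "makespan m J \<sigma> = load J \<sigma> k"
    using makespan_attained[OF assms(1)] .
  then show ?thesis
    using load_mono_prefix[OF assms(2,3)] makespan_ge by (metis order_trans)
qed

lemma makespan_nonneg: "m > 0 \<Longrightarrow> valid_input I \<Longrightarrow> 0 \<le> makespan m I \<sigma>"
  by (metis load_nonneg makespan_attained)

text \<open>Infinitely many functions \<sigma> exist, but every makespan is the load of one machine,
  hence the sum over some subset of the finitely many jobs. This makes minima over sets of solutions
  available.\<close>

lemma finite_range_makespan:
  assumes "m > 0"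
  shows "finite (range (makespan m I))"
proof (rule finite_subset)
  show "range (makespan m I) \<subseteq> (\<lambda>S. \<Sum>i\<in>S. I ! i) ` Pow {..<length I}"
  proof
    fix c assume "c \<in> range (makespan m I)"
    then obtain \<sigma> where "c = makespan m I \<sigma>" by auto
    moreover obtain k where "makespan m I \<sigma> = load I \<sigma> k"
      using makespan_attained[OF assms] .
    ultimately show "c \<in> (\<lambda>S. \<Sum>i\<in>S. I ! i) ` Pow {..<length I}"
      by (auto simp: load_def)
  qed
qed simp

section \<open>Greedy runs and the existence of an optimal bounded offline algorithm\<close>

lemma greedy_less: "is_greedy m A \<Longrightarrow> valid_input I \<Longrightarrow> p > 0 \<Longrightarrow> A I p < m"
  by (simp add: is_greedy_def)

lemma greedy_least:
  "is_greedy m A \<Longrightarrow> valid_input I \<Longrightarrow> p > 0 \<Longrightarrow> k < m \<Longrightarrow>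
    load I (run A I) (A I p) \<le> load I (run A I) k"
  by (simp add: is_greedy_def)

lemma is_solution_run:
  assumes "is_greedy m A" "valid_input I"
  shows "is_solution m I (run A I)"
  unfolding is_solution_def run_def
proof (intro allI impI)
  fix i assume "i < length I"
  then have "valid_input (take i I)" "I ! i > 0"
    using assms(2) by (auto simp: valid_input_def dest: in_set_takeD)
  then show "A (take i I) (I ! i) < m"
    by (rule greedy_less[OF assms(1)])
qed

text \<open>An online decision depends only on the jobs seen so far, so a run on \<open>I\<close>
  restricts to the run on each prefix. Consequently Greedy satisfies its own prefix bounds.\<close>

lemma makespan_run_prefix:
  assumes "prefix J I"
  shows "makespan m J (run A I) = online_cost m A J"
proof -
  obtain K where "I = J @ K"
    using assms by (auto simp: prefix_def)
  then have "load J (run A I) = load J (run A J)"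
    by (intro ext load_cong) (simp add: run_def nth_append)
  then show ?thesis
    by (simp add: online_cost_def makespan_def)
qed

lemma is_bounded_by_run: "is_greedy m A \<Longrightarrow> is_bounded_by m A (run A)"
  by (simp add: is_bounded_by_def is_solution_run makespan_run_prefix)

text \<open>Needed because \<open>Opt\<close> is a \<open>SOME\<close> choice. Being bounded
  constrains each input separately, so minimizers can be picked input by input: the feasible set
  \<open>F I\<close> contains Greedy's own run, and only finitely many makespans occur.\<close>

lemma ex_opt_bounded_by:
  assumes "m > 0" "is_greedy m A"
  shows "\<exists>B. is_opt_bounded_by m A B"
proof -
  define F where "F I = {\<sigma>. is_solution m I \<sigma> \<and>
      (\<forall>J. prefix J I \<longrightarrow> makespan m J \<sigma> \<le> online_cost m A J)}" for I
  have bdd: "is_bounded_by m A B \<longleftrightarrow> (\<forall>I. valid_input I \<longrightarrow> B I \<in> F I)" for B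
    by (simp add: is_bounded_by_def F_def)
  have "\<exists>\<sigma>. valid_input I \<longrightarrow> \<sigma> \<in> F I \<and> (\<forall>\<tau>\<in>F I. makespan m I \<sigma> \<le> makespan m I \<tau>)" for I
  proof (cases "valid_input I")
    case True
    have fin: "finite (makespan m I ` F I)"
      using finite_range_makespan[OF assms(1)] by (rule finite_subset[rotated]) auto
    have "run A I \<in> F I"
      using is_bounded_by_run[OF assms(2)] True by (simp add: bdd)
    then have "Min (makespan m I ` F I) \<in> makespan m I ` F I"
      using fin by (intro Min_in) auto
    then obtain \<sigma> where "\<sigma> \<in> F I" "makespan m I \<sigma> = Min (makespan m I ` F I)"
      by auto
    then show ?thesis
      using fin by auto
  qed simp
  then obtain B where "\<And>I. valid_input I \<Longrightarrow>
      B I \<in> F I \<and> (\<forall>\<tau>\<in>F I. makespan m I (B I) \<le> makespan m I \<tau>)"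
    by metis
  then have "is_opt_bounded_by m A B"
    unfolding is_opt_bounded_by_def bdd by blast
  then show ?thesis
    by (rule exI[where x = B])
qed

lemma is_opt_bounded_by_Opt:
  "m > 0 \<Longrightarrow> is_greedy m A \<Longrightarrow> is_opt_bounded_by m A (Opt m A)"
  unfolding Opt_def by (rule someI_ex[OF ex_opt_bounded_by])

text \<open>A solution for a single input becomes a bounded offline algorithm by following Greedy on
  all other inputs; optimality of \<open>Opt\<close> is then applied to that algorithm.\<close>

lemma opt_cost_le:
  assumes "m > 0" "is_greedy m A" "valid_input I" "is_solution m I \<sigma>"
    and "\<And>J. prefix J I \<Longrightarrow> makespan m J \<sigma> \<le> online_cost m A J"
  shows "opt_cost m A I \<le> makespan m I \<sigma>"
proof -
  define C where "C = (run A)(I := \<sigma>)"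
  have "is_bounded_by m A C"
    using is_bounded_by_run[OF assms(2)] assms(4,5) by (simp add: is_bounded_by_def C_def)
  then have "makespan m I (Opt m A I) \<le> makespan m I (C I)"
    using is_opt_bounded_by_Opt[OF assms(1,2)] assms(3) by (simp add: is_opt_bounded_by_def)
  then show ?thesis
    by (simp add: opt_cost_def C_def)
qed

section \<open>Upper bound on Greedy's cost\<close>

lemma sum_ge_delete:
  fixes f :: "nat \<Rightarrow> real"
  assumes "k < m" "\<And>i. i < m \<Longrightarrow> c \<le> f i"
  shows "(real m - 1) * c + f k \<le> (\<Sum>i<m. f i)"
proof -
  have "(\<Sum>i\<in>{..<m} - {k}. c) \<le> (\<Sum>i\<in>{..<m} - {k}. f i)"
    by (rule sum_mono) (use assms in auto)
  then show ?thesis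
    using assms(1) by (simp add: sum.remove[of "{..<m}" k] of_nat_diff)
qed

lemma sum_le_delete:
  fixes f :: "nat \<Rightarrow> real"
  assumes "k < m" "\<And>i. i < m \<Longrightarrow> i \<noteq> k \<Longrightarrow> f i \<le> c"
  shows "(\<Sum>i<m. f i) \<le> (real m - 1) * c + f k"
proof -
  have "(\<Sum>i\<in>{..<m} - {k}. f i) \<le> (\<Sum>i\<in>{..<m} - {k}. c)"
    by (rule sum_mono) (use assms in auto)
  then show ?thesis
    using assms(1) by (simp add: sum.remove[of "{..<m}" k] of_nat_diff)
qed

text \<open>Stated for any solution meeting the prefix bounds, not only an optimal one: these
  hypotheses pass from \<open>I @ [p]\<close> to \<open>I\<close>, which permits induction on the
  last job. Multiplying out by \<open>m - 1\<close> avoids division.\<close>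

lemma greedy_le_bounded_solution:
  assumes m: "m \<ge> 2" and greedy: "is_greedy m A"
    and "valid_input I" "is_solution m I \<sigma>"
    and "\<And>J. prefix J I \<Longrightarrow> makespan m J \<sigma> \<le> online_cost m A J"
  shows "(real m - 1) * online_cost m A I \<le> (2 * real m - 3) * makespan m I \<sigma>"
  using assms(3-)
proof (induction I rule: rev_induct)
  case Nil
  have "makespan m [] \<tau> = 0" for \<tau>
    using makespan_attained[of m "[]" \<tau>] m by fastforce
  then show ?case by (simp add: online_cost_def)
next
  case (snoc p I)
  have valid: "valid_input I" "p > 0"
    using snoc.prems(1) by auto
  have sol: "is_solution m I \<sigma>" "\<sigma> (length I) < m"
    using snoc.prems(2) by (auto simp: is_solution_def)
  define C where "C = makespan m (I @ [p]) \<sigma>"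
  define L where "L = load I (run A I) (A I p)"
  define M where "M = online_cost m A I"
  define q where "q = load I \<sigma> (\<sigma> (length I))"
  have mono: "makespan m I \<sigma> \<le> C"
    unfolding C_def using m snoc.prems(1) by (intro makespan_mono_prefix) auto
  have IH: "(real m - 1) * M \<le> (2 * real m - 3) * C"
  proof -
    have "(real m - 1) * M \<le> (2 * real m - 3) * makespan m I \<sigma>"
      unfolding M_def using valid sol snoc.prems(3) by (intro snoc.IH) auto
    also have "\<dots> \<le> (2 * real m - 3) * C"
      using mono m by (intro mult_left_mono) auto
    finally show ?thesis .
  qed
  obtain j where j: "j < m" "online_cost m A (I @ [p]) = load (I @ [p]) (run A (I @ [p])) j"
    unfolding online_cost_def using makespan_attained[of m] m by (metis pos2 order_less_le_trans)
  show ?case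
  proof (cases "j = A I p")
    \<comment> \<open>A fullest machine that did not receive \<open>p\<close> had the same load
      before, so the makespan did not grow and \<open>IH\<close> suffices.\<close>
    case False
    then have "online_cost m A (I @ [p]) \<le> M"
      using j makespan_ge[of j m I "run A I"] by (simp add: load_run_snoc M_def online_cost_def)
    then have "(real m - 1) * online_cost m A (I @ [p]) \<le> (real m - 1) * M"
      using m by (intro mult_left_mono) auto
    then show ?thesis
      using IH unfolding C_def by linarith
  next
    case True
    then have cost: "online_cost m A (I @ [p]) = L + p"
      using j by (simp add: load_run_snoc L_def)
    obtain k where k: "k < m" "M = load I (run A I) k"
      unfolding M_def online_cost_def
      using makespan_attained[of m] m by (metis pos2 order_less_le_trans)
    have "(real m - 1) * L + M \<le> sum_list I"
      using sum_ge_delete[of k m L "load I (run A I)"] k greedy_least[OF greedy valid]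
        sum_load[OF is_solution_run[OF greedy valid(1)]] by (simp add: L_def)
    moreover have "sum_list I \<le> (real m - 1) * min M C + q"
    proof -
      \<comment> \<open>The bound by \<open>M\<close> is the prefix condition at \<open>I\<close>;
        the bound by \<open>C\<close> holds because loads only grow.\<close>
      have "load I \<sigma> i \<le> min M C" if "i < m" for i
      proof -
        have "makespan m I \<sigma> \<le> M"
          unfolding M_def by (rule snoc.prems(3)) simp
        then show ?thesis
          using makespan_ge[OF that, of I \<sigma>] mono by linarith
      qed
      then show ?thesis
        using sum_le_delete[OF sol(2), of "load I \<sigma>" "min M C"] sum_load[OF sol(1)]
        by (simp add: q_def)
    qed
    \<comment> \<open>One copy of the minimum is charged to \<open>M\<close>, which cancels the load
      of Greedy's fullest machine; the others are charged to \<open>C\<close>.\<close>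
    moreover have "(real m - 1) * min M C \<le> M + (real m - 2) * C"
    proof -
      have "(real m - 2) * min M C \<le> (real m - 2) * C"
        using m by (intro mult_left_mono) auto
      moreover have "(real m - 1) * min M C = min M C + (real m - 2) * min M C"
        by (simp add: algebra_simps)
      ultimately show ?thesis
        by linarith
    qed
    ultimately have "(real m - 1) * L \<le> q + (real m - 2) * C"
      by linarith
    moreover have "p + q \<le> C"
      using makespan_ge[OF sol(2), of "I @ [p]" \<sigma>] by (simp add: load_snoc q_def C_def)
    then have "(real m - 1) * (p + q) \<le> (real m - 1) * C"
      using m by (intro mult_left_mono) auto
    \<comment> \<open>Adding the two preceding estimates leaves the term
      \<open>- (m - 2) * q\<close>, which may be dropped.\<close>
    moreover have "q \<ge> 0"
      unfolding q_def using valid(1) by (rule load_nonneg)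
    then have "0 \<le> (real m - 2) * q"
      using m by simp
    ultimately have "(real m - 1) * (L + p) \<le> (2 * real m - 3) * C"
      by (simp add: algebra_simps)
    then show ?thesis
      by (simp add: cost C_def)
  qed
qed

section \<open>Lower bound: the adversarial input\<close>

definition adversary :: "nat \<Rightarrow> real list" where
  "adversary m = (real m - 1) # replicate ((m - 1) * (m - 2)) 1 @ [real m - 1]"

lemma valid_input_adversary: "m \<ge> 2 \<Longrightarrow> valid_input (adversary m)"
  by (simp add: adversary_def valid_input_def)

text \<open>Integrality sharpens a load below \<open>m - 2\<close> to one of at most
  \<open>m - 3\<close>, which leaves room for a whole unit job.\<close>

lemma load_Ints:
  assumes "set I \<subseteq> \<int>"
  shows "load I \<sigma> k \<in> \<int>"
  unfolding load_def using assms by (intro Ints_sum) auto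

text \<open>If the least load were already \<open>m - 2\<close> or more when a unit job arrives, the
  machines other than \<open>k0\<close> would hold at least \<open>(m - 1) * (m - 2)\<close> units,
  more than have arrived. So the job finds a machine with room, and that machine is not
  \<open>k0\<close>.\<close>

lemma greedy_load_unit_jobs:
  fixes m :: nat and A :: online_alg
  defines "k0 \<equiv> A [] (real m - 1)"
    and "I \<equiv> \<lambda>n. (real m - 1) # replicate n 1"
  assumes m: "m \<ge> 2" and greedy: "is_greedy m A" and n: "n \<le> (m - 1) * (m - 2)"
  shows "load (I n) (run A (I n)) k0 = real m - 1 \<and>
    (\<forall>k<m. k \<noteq> k0 \<longrightarrow> load (I n) (run A (I n)) k \<le> real m - 2)"
  using n
proof (induction n)
  case 0
  then show ?case
    using load_run_snoc[of "[]" "real m - 1" A] m by (simp add: k0_def I_def)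
next
  case (Suc n)
  define \<sigma> where "\<sigma> = run A (I n)"
  define a where "a = A (I n) 1"
  have snoc: "I (Suc n) = I n @ [1]"
    by (simp add: I_def flip: replicate_append_same)
  have IH: "load (I n) \<sigma> k0 = real m - 1"
    "\<And>k. k < m \<Longrightarrow> k \<noteq> k0 \<Longrightarrow> load (I n) \<sigma> k \<le> real m - 2"
    using Suc unfolding \<sigma>_def by auto
  have valid: "valid_input (I n)"
    using m by (simp add: I_def valid_input_def)
  have k0: "k0 < m"
    unfolding k0_def using greedy m by (intro greedy_less) (auto simp: valid_input_def)
  have a: "a < m"
    unfolding a_def using greedy valid by (intro greedy_less) auto
  have "load (I n) \<sigma> a < real m - 2"
  proof (rule ccontr)
    assume *: "\<not> load (I n) \<sigma> a < real m - 2"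
    have "real m - 2 \<le> load (I n) \<sigma> k" if "k < m" for k
      using greedy_least[OF greedy valid _ that, of 1] * by (simp add: a_def \<sigma>_def)
    then have "(real m - 1) * (real m - 2) + load (I n) \<sigma> k0 \<le> sum_list (I n)"
      using sum_ge_delete[OF k0] sum_load[OF is_solution_run[OF greedy valid]]
      by (metis \<sigma>_def)
    then have "(real m - 1) * (real m - 2) \<le> real n"
      by (simp add: IH(1)) (simp add: I_def sum_list_replicate)
    moreover have "real n < real ((m - 1) * (m - 2))"
      using Suc.prems by linarith
    ultimately show False
      using m by (simp add: of_nat_diff)
  qed
  moreover have "load (I n) \<sigma> a \<in> \<int>"
    by (rule load_Ints) (use m in \<open>auto simp: I_def\<close>)
  then obtain z where "load (I n) \<sigma> a = of_int z"
    by (auto elim: Ints_cases)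
  moreover have "z \<le> int m - 3" if "real_of_int z < real m - 2"
    using that by linarith
  ultimately have "load (I n) \<sigma> a \<le> real m - 3" "a \<noteq> k0"
    using IH(1) by fastforce+
  then show ?case
    using IH unfolding snoc load_run_snoc a_def[symmetric] \<sigma>_def[symmetric] by auto
qed

text \<open>The unit jobs fill the \<open>m - 1\<close> machines other than \<open>k0\<close>
  exactly to \<open>m - 2\<close>, since none exceeds this and the total leaves no slack. The last
  job therefore lands on a load of at least \<open>m - 2\<close>.\<close>

lemma greedy_cost_adversary:
  assumes m: "m \<ge> 2" and greedy: "is_greedy m A"
  shows "2 * real m - 3 \<le> online_cost m A (adversary m)"
proof -
  define I where "I = (real m - 1) # replicate ((m - 1) * (m - 2)) 1"
  define k0 where "k0 = A [] (real m - 1)"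
  define a where "a = A I (real m - 1)"
  define f where "f = load I (run A I)"
  have adv: "adversary m = I @ [real m - 1]"
    by (simp add: adversary_def I_def)
  have valid: "valid_input I"
    using m by (simp add: I_def valid_input_def)
  have k0: "k0 < m"
    unfolding k0_def using greedy m by (intro greedy_less) (auto simp: valid_input_def)
  have a: "a < m"
    unfolding a_def using greedy valid m by (intro greedy_less) auto
  have f: "f k0 = real m - 1" "\<And>k. k < m \<Longrightarrow> k \<noteq> k0 \<Longrightarrow> f k \<le> real m - 2"
    using greedy_load_unit_jobs[OF m greedy order_refl] by (auto simp: f_def I_def k0_def)
  have total: "(\<Sum>k<m. f k) = (real m - 1) + (real m - 1) * (real m - 2)"
    using sum_load[OF is_solution_run[OF greedy valid]] m
    by (simp add: f_def) (simp add: I_def sum_list_replicate of_nat_diff)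
  have "real m - 2 \<le> f a"
  proof (cases "a = k0")
    \<comment> \<open>The \<open>m - 2\<close> machines besides \<open>k0\<close> and
      \<open>a\<close> absorb at most \<open>m - 2\<close> each, so the rest of the total is on
      \<open>a\<close>.\<close>
    case False
    have "(\<Sum>k\<in>{..<m} - {k0} - {a}. f k) \<le> (\<Sum>k\<in>{..<m} - {k0} - {a}. real m - 2)"
      using f by (intro sum_mono) auto
    also have "\<dots> = (real m - 2) * (real m - 2)"
      using k0 a False m by (simp add: card_Diff_singleton of_nat_diff)
    finally have "(\<Sum>k<m. f k) \<le> f k0 + (f a + (real m - 2) * (real m - 2))"
      using k0 a False by (simp add: sum.remove[of "{..<m}" k0] sum.remove[of "{..<m} - {k0}" a])
    then show ?thesis
      using total f(1) by (simp add: algebra_simps)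
  qed (simp add: f)
  moreover have "load (adversary m) (run A (adversary m)) a = f a + (real m - 1)"
    unfolding adv load_run_snoc f_def by (simp add: a_def)
  moreover have "load (adversary m) (run A (adversary m)) a \<le> online_cost m A (adversary m)"
    unfolding online_cost_def using a by (rule makespan_ge)
  ultimately show ?thesis
    by linarith
qed

text \<open>Job 0 is alone on machine 0, consecutive blocks of \<open>m - 1\<close> unit jobs go to
  machines 1 to \<open>m - 2\<close>, and the final job, at index
  \<open>(m - 1) * (m - 2) + 1\<close>, starts a new block on machine \<open>m - 1\<close>.\<close>

definition adversary_solution :: "nat \<Rightarrow> nat \<Rightarrow> nat" where
  "adversary_solution m i = (if i = 0 then 0 else Suc ((i - 1) div (m - 1)))"

lemma is_solution_adversary:
  assumes "m \<ge> 2"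
  shows "is_solution m (adversary m) (adversary_solution m)"
  unfolding is_solution_def
proof (intro allI impI)
  fix i assume "i < length (adversary m)"
  then have "i - 1 \<le> (m - 2) * (m - 1)"
    by (simp add: adversary_def mult.commute)
  then have "(i - 1) div (m - 1) \<le> m - 2"
    using assms by (metis div_le_mono nonzero_mult_div_cancel_right diff_is_0_eq
        not_less_eq_eq numeral_2_eq_2 One_nat_def)
  then show "adversary_solution m i < m"
    using assms by (auto simp: adversary_solution_def)
qed

lemma makespan_adversary_solution:
  assumes m: "m \<ge> 2"
  shows "makespan m (adversary m) (adversary_solution m) \<le> real m - 1"
proof -
  obtain k where k: "k < m"
    "makespan m (adversary m) (adversary_solution m) = load (adversary m) (adversary_solution m) k"
    using makespan_attained[of m] m by (metis pos2 order_less_le_trans)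
  define S where "S = {i. i < length (adversary m) \<and> adversary_solution m i = k}"
  have len: "length (adversary m) = (m - 1) * (m - 2) + 2"
    by (simp add: adversary_def)
  have "(\<Sum>i\<in>S. adversary m ! i) \<le> real m - 1"
  proof -
    consider "k = 0" | "k = m - 1" "k \<noteq> 0" | "0 < k" "k < m - 1"
      using k(1) by linarith
    then show ?thesis
    proof cases
      case 1
      then have "S = {0}"
        by (auto simp: S_def adversary_solution_def len)
      then show ?thesis
        by (simp add: adversary_def)
    next
      case 2
      have "S \<subseteq> {(m - 1) * (m - 2) + 1}"
      proof
        fix i assume "i \<in> S"
        then have i: "i < (m - 1) * (m - 2) + 2" "i > 0" "(i - 1) div (m - 1) = m - 2"
          using 2 by (auto simp: S_def len adversary_solution_def split: if_splits)
        have "(m - 1) * (m - 2) \<le> i - 1"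
          using i(3) by (metis times_div_less_eq_dividend)
        then have "i = (m - 1) * (m - 2) + 1"
          using i(1,2) by linarith
        then show "i \<in> {(m - 1) * (m - 2) + 1}"
          by simp
      qed
      then have "(\<Sum>i\<in>S. adversary m ! i) \<le> (\<Sum>i\<in>{(m - 1) * (m - 2) + 1}. adversary m ! i)"
        using m by (intro sum_mono2) (auto simp: adversary_def nth_append)
      also have "\<dots> = real m - 1"
        by (simp add: adversary_def nth_append)
      finally show ?thesis .
    next
      case 3
      have sub: "S \<subseteq> {(m - 1) * (k - 1) + 1 ..< (m - 1) * (k - 1) + m}"
      proof
        fix i assume "i \<in> S"
        then have i: "i > 0" "(i - 1) div (m - 1) = k - 1"
          using 3 by (auto simp: S_def adversary_solution_def split: if_splits)
        have "i - 1 = (m - 1) * (k - 1) + (i - 1) mod (m - 1)"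
          using i(2) by (metis mult_div_mod_eq)
        moreover have "(i - 1) mod (m - 1) < m - 1"
          using m by simp
        ultimately show "i \<in> {(m - 1) * (k - 1) + 1 ..< (m - 1) * (k - 1) + m}"
          using i(1) unfolding atLeastLessThan_iff by linarith
      qed
      \<comment> \<open>The block starts after index 0 and ends before the index of the final large
        job, so it contains unit jobs only.\<close>
      have "(m - 1) * (k - 1) + m \<le> (m - 1) * (m - 2) + 1"
      proof -
        have "(m - 1) * (k - 1) + (m - 1) = (m - 1) * k"
          using 3 by (cases k) auto
        moreover have "(m - 1) * k \<le> (m - 1) * (m - 2)"
          using 3 by (intro mult_le_mono2) simp
        ultimately show ?thesis
          using m by linarith
      qed
      then have "adversary m ! i = 1" if "i \<in> S" for i
        using that sub by (force simp: adversary_def nth_append nth_Cons')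
      then have "(\<Sum>i\<in>S. adversary m ! i) = real (card S)"
        by simp
      also have "card S \<le> m - 1"
        using card_mono[OF _ sub] by simp
      finally show ?thesis
        using m by (simp add: of_nat_diff)
    qed
  qed
  then show ?thesis
    by (simp add: k load_def S_def)
qed

text \<open>On a nonempty prefix Greedy already pays at least \<open>m - 1\<close> for the first
  job, so the prefix bounds reduce to the final makespan of
  \<open>adversary_solution\<close>.\<close>

lemma opt_cost_adversary:
  assumes m: "m \<ge> 2" and greedy: "is_greedy m A"
  shows "opt_cost m A (adversary m) \<le> real m - 1"
proof -
  have pos: "m > 0"
    using m by simp
  have "makespan m J (adversary_solution m) \<le> online_cost m A J"
    if J: "prefix J (adversary m)" for J
  proof (cases J)
    case Nil
    then show ?thesis
      using pos by (simp add: online_cost_def makespan_def)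
  next
    case (Cons p K)
    then have p: "p = real m - 1"
      using J by (simp add: adversary_def)
    have valid: "valid_input J"
      using J valid_input_adversary[OF m] by (auto simp: prefix_def)
    have "makespan m J (adversary_solution m) \<le> real m - 1"
      using makespan_mono_prefix[OF pos valid_input_adversary[OF m] J]
        makespan_adversary_solution[OF m] by (rule order_trans)
    also have "\<dots> = load [p] (run A J) (run A J 0)"
      using load_snoc[of "[]" p "run A J"] by (simp add: p)
    also have "\<dots> \<le> load J (run A J) (run A J 0)"
      using Cons valid by (intro load_mono_prefix) auto
    also have "\<dots> \<le> online_cost m A J"
      unfolding online_cost_def using is_solution_run[OF greedy valid] Cons
      by (intro makespan_ge) (simp add: is_solution_def)
    finally show ?thesis .
  qed
  then have "opt_cost m A (adversary m) \<le> makespan m (adversary m) (adversary_solution m)"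
    by (intro opt_cost_le pos greedy valid_input_adversary is_solution_adversary m)
  then show ?thesis
    using makespan_adversary_solution[OF m] by linarith
qed

section \<open>From the two bounds to the infimum of admissible constants\<close>

theorem theorem2:
  fixes m :: nat and A :: online_alg
  assumes "m \<ge> 2" and "is_greedy m A"
  shows "online_bounded_ratio m A = ereal (2 - 1 / (real m - 1))"
proof -
  note m = assms(1) and greedy = assms(2)
  have pos: "m > 0" "real m - 1 > 0"
    using m by auto
  have ratio: "2 - 1 / (real m - 1) = (2 * real m - 3) / (real m - 1)"
    using pos by (simp add: field_simps)
  have bounded: "is_bounded_by m A (Opt m A)"
    using is_opt_bounded_by_Opt[OF pos(1) greedy] by (simp add: is_opt_bounded_by_def)
  have upper: "online_cost m A I \<le> (2 - 1 / (real m - 1)) * opt_cost m A I" if "valid_input I" for I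
  proof -
    have "(real m - 1) * online_cost m A I \<le> (2 * real m - 3) * opt_cost m A I"
      unfolding opt_cost_def using bounded that
      by (intro greedy_le_bounded_solution m greedy) (auto simp: is_bounded_by_def)
    then show ?thesis
      using pos(2) by (simp add: ratio pos_le_divide_eq mult.commute)
  qed
  have lower: "2 - 1 / (real m - 1) \<le> c"
    if c: "\<And>I. valid_input I \<Longrightarrow> online_cost m A I \<le> c * opt_cost m A I" for c
  proof -
    have le: "2 * real m - 3 \<le> c * opt_cost m A (adversary m)"
      using greedy_cost_adversary[OF m greedy] c[OF valid_input_adversary[OF m]] by linarith
    have nonneg: "0 \<le> opt_cost m A (adversary m)"
      unfolding opt_cost_def by (intro makespan_nonneg pos valid_input_adversary m)
    \<comment> \<open>The optimal cost is only known to be at most \<open>m - 1\<close>; multiplying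
      this by \<open>c\<close> requires its sign. A negative \<open>c\<close> would contradict
      \<open>2 * m - 3 > 0\<close>.\<close>
    have "0 \<le> c"
    proof (rule ccontr)
      assume "\<not> 0 \<le> c"
      then have "c * opt_cost m A (adversary m) \<le> 0"
        using nonneg by (simp add: mult_nonpos_nonneg)
      then show False
        using le m by simp
    qed
    then have "c * opt_cost m A (adversary m) \<le> c * (real m - 1)"
      using opt_cost_adversary[OF m greedy] by (intro mult_left_mono)
    then show ?thesis
      using le pos(2) by (simp add: ratio pos_divide_le_eq)
  qed
  show ?thesis
    unfolding online_bounded_ratio_def
  proof (rule antisym)
    show "Inf {ereal c |c. \<forall>I. valid_input I \<longrightarrow> online_cost m A I \<le> c * opt_cost m A I}
        \<le> ereal (2 - 1 / (real m - 1))"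
      using upper by (intro Inf_lower) blast
    show "ereal (2 - 1 / (real m - 1))
        \<le> Inf {ereal c |c. \<forall>I. valid_input I \<longrightarrow> online_cost m A I \<le> c * opt_cost m A I}"
      using lower by (intro Inf_greatest) auto
  qed
qed

end
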